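(* Suppose there exists a $t$-$(v,k,\lambda)$-design with $\lambda\geq 1$. Let $t_0,t_1,t_2$ be positive integers such that $t_0=t_1+t_2\leq t$. Then for each of the following three sets of parameters, every $(K,M,N)$ caching system with the given $K$ and the given ratio $\frac{M}{N}$ admits an $F$-division caching scheme with rate $R$: 1) $K=\dfrac{\lambda\binom{v}{t_1}\binom{v-t_1}{t-t_1}}{\binom{k-t_1}{t-t_1}}$, $\ \frac{M}{N}=1-\dfrac{\binom{k-t_1}{t_2}\binom{k-t_2}{t-t_2}}{\lambda\binom{v}{t_2}\binom{v-t_2}{t-t_2}}$, $\ R=\dfrac{\binom{k}{t_0}}{\binom{k}{t_2}}$, $\ F=\dfrac{\lambda\binom{v}{t_2}\binom{v-t_2}{t-t_2}}{\binom{k-t_2}{t-t_2}}$; 2) $K=\dfrac{\lambda\binom{v}{t_1}\binom{v-t_1}{t-t_1}}{\binom{k-t_1}{t-t_1}}$, $\ \frac{M}{N}=1-\dfrac{\binom{k-t_1}{t_2}\binom{k-t_0}{t-t_0}}{\lambda\binom{v}{t_0}\binom{v-t_0}{t-t_0}}$, $\ R=\dfrac{\binom{k}{t_2}}{\binom{k}{t_0}}$, $\ F=\dfrac{\lambda\binom{v}{t_0}\binom{v-t_0}{t-t_0}}{\binom{k-t_0}{t-t_0}}$; 3) $K=\dfrac{\lambda\binom{v}{t_0}\binom{v-t_0}{t-t_0}}{\binom{k-t_0}{t-t_0}}$, $\ \frac{M}{N}=1-\dfrac{\binom{t_0}{t_1}\binom{k-t_1}{t-t_1}}{\lambda\binom{v}{t_1}\binom{v-t_1}{t-t_1}}$,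 $\ R=\dfrac{\binom{k}{t_2}}{\binom{k}{t_1}}$, $\ F=\dfrac{\lambda\binom{v}{t_1}\binom{v-t_1}{t-t_1}}{\binom{k-t_1}{t-t_1}}$.
   Context: $t$-design: let $v,k,\lambda,t$ be positive integers with $v>k\geq t$. A $t$-$(v,k,\lambda)$-design is a pair $(V,\mathcal{B})$, where $V$ is a set of points with $|V|=v$ and $\mathcal{B}$ is a collection (multiset, so repeated blocks are allowed) of $k$-subsets of $V$ (blocks), such that every $t$-subset of $V$ is contained in exactly $\lambda$ blocks (counted with multiplicity). For $0\le s\le t$, every $s$-subset of $V$ is then contained in exactly $\lambda\binom{v-s}{t-s}/\binom{k-s}{t-s}$ blocks. Caching system and caching scheme: fix a finite field $\mathbb{F}$ (e.g. $\mathbb{F}=\mathbb{F}_2$), and write $[n]=\{1,\dots,n\}$. A $(K,M,N)$ caching system consists of one server with $N$ files $\mathbf{W}_1,\dots,\mathbf{W}_N$ and $K$ users, each with a cache of size $M$, $0\le M\le N$. For a positive integer $F$ (the subpacketization; with $MF$ an integer), each file is a vector $\mathbf{W}_i\in\mathbb{F}^F$. An $F$-division caching scheme with rate $R$ for the $(K,M,N)$ caching system consists of: caching functions $\phi_k:\mathbb{F}^{NF}\to\mathbb{F}^{MF}$ for $k\in[K]$; encoding functions $\varphi_{\mathbf{d}}:\mathbb{F}^{NF}\to\mathbb{F}^{\lfloor RF\rfloor}$ for $\mathbf{d}\in[N]^K$; and decoding functions $\mu_{k,\mathbf{d}}:\mathbb{F}^{MF}\times\mathbb{F}^{\lfloor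 RF\rfloor}\to\mathbb{F}^{F}$ for $k\in[K]$, $\mathbf{d}\in[N]^K$; such that for all $k\in[K]$, all $\mathbf{d}=(d_1,\dots,d_K)\in[N]^K$, and all files $\mathbf{W}_1,\dots,\mathbf{W}_N\in\mathbb{F}^F$, $$\mathbf{W}_{d_k}=\mu_{k,\mathbf{d}}\bigl(\phi_k(\mathbf{W}_1,\dots,\mathbf{W}_N),\ \varphi_{\mathbf{d}}(\mathbf{W}_1,\dots,\mathbf{W}_N)\bigr).$$ (Here the user index $k\in[K]$ is unrelated to the block size $k$.) *)

theory Defs
  imports Complex_Main "HOL-Library.FuncSet" "HOL-Library.Multiset" "Jordan_Normal_Form.Matrix"
begin

text \<open>Blocks form a multiset, so repeated blocks are allowed and all counts are with
  multiplicity.\<close>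

definition t_design :: "'p set \<Rightarrow> 'p set multiset \<Rightarrow> nat \<Rightarrow> nat \<Rightarrow> nat \<Rightarrow> nat \<Rightarrow> bool" where
  "t_design V B t v k lam \<longleftrightarrow>
     0 < v \<and> 0 < k \<and> 0 < lam \<and> 0 < t \<and> k < v \<and> t \<le> k \<and>
     finite V \<and> card V = v \<and>
     (\<forall>b \<in># B. b \<subseteq> V \<and> card b = k) \<and>
     (\<forall>T. T \<subseteq> V \<and> card T = t \<longrightarrow> size {#b \<in># B. T \<subseteq> b#} = lam)"

definition caching_system :: "nat \<Rightarrow> real \<Rightarrow> nat \<Rightarrow> bool" where
  "caching_system K M N \<longleftrightarrow> 0 < K \<and> 0 < N \<and> 0 \<le> M \<and> M \<le> real N"

text \<open>The files \<open>W 1, \<dots>, W N\<close>, each a vector of dimension \<open>F\<close>, written one after the other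
  as a single vector of dimension \<open>N * F\<close> (vector entries are indexed from \<open>0\<close>).\<close>

definition concat_files :: "nat \<Rightarrow> nat \<Rightarrow> (nat \<Rightarrow> 'a vec) \<Rightarrow> 'a vec" where
  "concat_files N F W = vec (N * F) (\<lambda>j. W (j div F + 1) $ (j mod F))"

text \<open>\<open>phi u\<close> is the caching function of user \<open>u\<close>, \<open>enc d\<close> the encoding function for the demand
  vector \<open>d\<close>, and \<open>dec u d\<close> the decoding function of user \<open>u\<close> for \<open>d\<close>.  The extensional function
  space represents \<open>[N]^K\<close>.\<close>

definition caching_scheme ::
  "nat \<Rightarrow> real \<Rightarrow> nat \<Rightarrow> nat \<Rightarrow> real \<Rightarrow>
   (nat \<Rightarrow> 'a::{field,finite} vec \<Rightarrow> 'a vec) \<Rightarrow>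
   ((nat \<Rightarrow> nat) \<Rightarrow> 'a vec \<Rightarrow> 'a vec) \<Rightarrow>
   (nat \<Rightarrow> (nat \<Rightarrow> nat) \<Rightarrow> 'a vec \<times> 'a vec \<Rightarrow> 'a vec) \<Rightarrow> bool" where
  "caching_scheme K M N F R phi enc dec \<longleftrightarrow>
     caching_system K M N \<and> 0 < F \<and> M * real F \<in> \<int> \<and> 0 \<le> R \<and>
     (\<forall>u \<in> {1..K}.
        phi u \<in> carrier_vec (N * F) \<rightarrow> carrier_vec (nat \<lfloor>M * real F\<rfloor>)) \<and>
     (\<forall>d \<in> {1..K} \<rightarrow>\<^sub>E {1..N}.
        enc d \<in> carrier_vec (N * F) \<rightarrow> carrier_vec (nat \<lfloor>R * real F\<rfloor>)) \<and>
     (\<forall>u \<in> {1..K}. \<forall>d \<in> {1..K} \<rightarrow>\<^sub>E {1..N}.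
        dec u d \<in> carrier_vec (nat \<lfloor>M * real F\<rfloor>) \<times> carrier_vec (nat \<lfloor>R * real F\<rfloor>)
                    \<rightarrow> carrier_vec F) \<and>
     (\<forall>u \<in> {1..K}. \<forall>d \<in> {1..K} \<rightarrow>\<^sub>E {1..N}. \<forall>W \<in> {1..N} \<rightarrow> carrier_vec F.
        W (d u) = dec u d (phi u (concat_files N F W), enc d (concat_files N F W)))"

text \<open>The type argument selects the finite field over which the scheme operates.\<close>

definition admits_caching_scheme ::
  "'a::{field,finite} itself \<Rightarrow> nat \<Rightarrow> real \<Rightarrow> nat \<Rightarrow> nat \<Rightarrow> real \<Rightarrow> bool" where
  "admits_caching_scheme ty K M N F R \<longleftrightarrow>
     (\<exists>(phi :: nat \<Rightarrow> 'a vec \<Rightarrow> 'a vec) enc dec. caching_scheme K M N F R phi enc dec)"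

end

theory Submission
  imports Defs
begin

text \<open>Each of the three schemes is a placement delivery array: a user \<open>x\<close> does not cache the row
  (subfile) \<open>y\<close> exactly when \<open>P x y\<close>, and then obtains it from the transmission \<open>e x y\<close>, which is the
  sum of all requested subfiles carrying this symbol; every other summand is cached by \<open>x\<close>.
  With \<open>b\<close> the number of blocks, double counting gives \<open>b * (k choose t) = lam * (v choose t)\<close>, and all
  parameters become those of \<open>b\<close> disjoint copies of an array on subsets of a single \<open>k\<close>-set:
  user \<open>A\<close> misses \<open>T\<close> if \<open>A \<inter> T = {}\<close> and gets it from the symbol \<open>A \<union> T\<close>; user \<open>A\<close> misses \<open>U\<close> if
  \<open>A \<subseteq> U\<close>, with symbol \<open>U - A\<close>; and user \<open>U\<close> misses \<open>A\<close> if \<open>A \<subseteq> U\<close>, again with symbol \<open>U - A\<close>.\<close>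

section \<open>Placement delivery arrays\<close>

definition pda :: "'x set \<Rightarrow> 'y set \<Rightarrow> 'z set \<Rightarrow> ('x \<Rightarrow> 'y \<Rightarrow> bool) \<Rightarrow> ('x \<Rightarrow> 'y \<Rightarrow> 'z) \<Rightarrow> nat \<Rightarrow> bool" where
  "pda X Y Z P e c \<longleftrightarrow> finite X \<and> finite Y \<and> finite Z \<and>
     (\<forall>x\<in>X. card {y\<in>Y. P x y} = c) \<and>
     (\<forall>x\<in>X. \<forall>y\<in>Y. P x y \<longrightarrow> e x y \<in> Z) \<and>
     (\<forall>x\<in>X. \<forall>y\<in>Y. \<forall>x'\<in>X. \<forall>y'\<in>Y.
        P x y \<longrightarrow> P x' y' \<longrightarrow> e x y = e x' y' \<longrightarrow> (x, y) \<noteq> (x', y') \<longrightarrow> \<not> P x y')"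

text \<open>The last condition is taken in contrapositive form. Speaking of the cell
  \<open>(x, y')\<close> alone suffices, since exchanging the two pairs yields
  \<open>(x', y)\<close>. For \<open>x = x'\<close> or \<open>y = y'\<close> it says that a symbol
  does not repeat within one user or one row.\<close>

lemma pdaI:
  assumes "finite X" "finite Y" "finite Z"
    and "\<And>x. x \<in> X \<Longrightarrow> card {y\<in>Y. P x y} = c"
    and "\<And>x y. x \<in> X \<Longrightarrow> y \<in> Y \<Longrightarrow> P x y \<Longrightarrow> e x y \<in> Z"
    and "\<And>x y x' y'. \<lbrakk>x \<in> X; y \<in> Y; x' \<in> X; y' \<in> Y; P x y; P x' y'; e x y = e x' y'; P x y'\<rbrakk>
           \<Longrightarrow> x = x' \<and> y = y'"
  shows "pda X Y Z P e c"
  unfolding pda_def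
proof (intro conjI ballI impI notI)
  fix x y x' y'
  assume "x \<in> X" "y \<in> Y" "x' \<in> X" "y' \<in> Y" "P x y" "P x' y'" "e x y = e x' y'" "P x y'"
    and ne: "(x, y) \<noteq> (x', y')"
  then have "x = x' \<and> y = y'" by (intro assms(6))
  with ne show False by simp
qed (simp_all add: assms(1-5))

lemma
  assumes "pda X Y Z P e c"
  shows pda_finite: "finite X" "finite Y" "finite Z"
    and pda_card: "x \<in> X \<Longrightarrow> card {y\<in>Y. P x y} = c"
    and pda_symbol: "x \<in> X \<Longrightarrow> y \<in> Y \<Longrightarrow> P x y \<Longrightarrow> e x y \<in> Z"
    and pda_unique: "\<lbrakk>x \<in> X; y \<in> Y; x' \<in> X; y' \<in> Y; P x y; P x' y'; e x y = e x' y'; P x y'\<rbrakk>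
           \<Longrightarrow> x = x' \<and> y = y'"
proof -
  show "finite X" "finite Y" "finite Z" using assms by (simp_all add: pda_def)
  show "x \<in> X \<Longrightarrow> card {y\<in>Y. P x y} = c" using assms by (simp add: pda_def)
  show "x \<in> X \<Longrightarrow> y \<in> Y \<Longrightarrow> P x y \<Longrightarrow> e x y \<in> Z" using assms by (simp add: pda_def)
  assume h: "x \<in> X" "y \<in> Y" "x' \<in> X" "y' \<in> Y" "P x y" "P x' y'" "e x y = e x' y'" "P x y'"
  have "\<forall>x\<in>X. \<forall>y\<in>Y. \<forall>x'\<in>X. \<forall>y'\<in>Y. P x y \<longrightarrow> P x' y' \<longrightarrow> e x y = e x' y' \<longrightarrow> (x, y) \<noteq> (x', y')
          \<longrightarrow> \<not> P x y'"
    using assms unfolding pda_def by (elim conjE)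
  then show "x = x' \<and> y = y'" using h by (metis prod.inject)
qed

section \<open>From an array to a caching scheme\<close>

text \<open>Division with remainder: position \<open>q * F + r\<close> is entry \<open>r\<close> of
  file number \<open>q + 1\<close>. With \<open>S\<close> the rows that a user caches, the count is
  its cache size, as the same rows are stored of every file.\<close>

lemma card_residues_in:
  fixes F N :: nat
  assumes "S \<subseteq> {..<F}"
  shows "card {j. j < N * F \<and> j mod F \<in> S} = N * card S"
proof -
  have "bij_betw (\<lambda>(q, r). q * F + r) ({..<N} \<times> S) {j. j < N * F \<and> j mod F \<in> S}"
  proof (rule bij_betwI[where g = "\<lambda>j. (j div F, j mod F)"])
    have "q * F + r < N * F" if "q < N" "r < F" for q r
    proof -
      have "q * F + r < Suc q * F" using that by simp
      also have "\<dots> \<le> N * F" using that by (intro mult_le_mono1) simp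
      finally show ?thesis .
    qed
    then show "(\<lambda>(q, r). q * F + r) \<in> {..<N} \<times> S \<rightarrow> {j. j < N * F \<and> j mod F \<in> S}"
      using assms by auto
    show "(\<lambda>j. (j div F, j mod F)) \<in> {j. j < N * F \<and> j mod F \<in> S} \<rightarrow> {..<N} \<times> S"
      by (auto simp: less_mult_imp_div_less)
  qed (use assms in auto)
  then show ?thesis
    by (simp add: bij_betw_same_card[symmetric] card_cartesian_product)
qed

lemma file_position_less:
  fixes F N n r :: nat
  assumes "n \<in> {1..N}" "r < F"
  shows "(n - 1) * F + r < N * F"
proof -
  have "(n - 1) * F + r < Suc (n - 1) * F" unfolding mult_Suc using assms by simp
  also have "\<dots> \<le> N * F" using assms by (intro mult_le_mono1) simp
  finally show ?thesis .
qed

lemma concat_files_index: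
  assumes "n \<in> {1..N}" "r < F"
  shows "concat_files N F W $ ((n - 1) * F + r) = W n $ r"
  using assms file_position_less[OF assms] by (simp add: concat_files_def)

text \<open>Reduces decoding to injectivity: with \<open>f W\<close> the data available to a user
  and \<open>g W\<close> the wanted file, a decoder exists as soon as the former determines the
  latter. Data that never occur are sent to the default \<open>c\<close>, so that \<open>h\<close>
  maps every argument into \<open>C\<close>.\<close>

lemma decoder_exists:
  assumes "\<And>W. W \<in> A \<Longrightarrow> g W \<in> C"
    and "\<And>W W'. W \<in> A \<Longrightarrow> W' \<in> A \<Longrightarrow> f W = f W' \<Longrightarrow> g W = g W'"
    and "c \<in> C"
  shows "\<exists>h. (\<forall>x. h x \<in> C) \<and> (\<forall>W\<in>A. g W = h (f W))"
proof -
  have "\<forall>x. \<exists>y. y \<in> C \<and> (\<forall>W\<in>A. x = f W \<longrightarrow> g W = y)"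
  proof
    fix x
    show "\<exists>y. y \<in> C \<and> (\<forall>W\<in>A. x = f W \<longrightarrow> g W = y)"
    proof (cases "\<exists>W\<in>A. x = f W")
      case True
      then obtain W where W: "W \<in> A" "x = f W" by blast
      have "\<forall>W'\<in>A. x = f W' \<longrightarrow> g W' = g W" using W assms(2) by blast
      then show ?thesis using W(1) assms(1) by blast
    next
      case False
      then show ?thesis using assms(3) by blast
    qed
  qed
  then obtain h where "\<forall>x. h x \<in> C \<and> (\<forall>W\<in>A. x = f W \<longrightarrow> g W = h x)"
    using choice by metis
  then show ?thesis by auto
qed

lemma pda_nat_admits:
  fixes e :: "nat \<Rightarrow> nat \<Rightarrow> nat"
  assumes pda: "pda {1..K} {..<F} {..<S} P e c"
    and sys: "caching_system K M N" and F: "0 < F"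
    and M: "M * real F = real (N * (F - c))" and R: "0 \<le> R" "R * real F = real S"
  shows "admits_caching_scheme TYPE('a::{field,finite}) K M N F R"
proof -
  \<comment> \<open>\<open>C u\<close> holds the positions of the concatenated files that user
    \<open>u\<close> caches. It does not depend on the demands.\<close>
  define C where "C u = {j. j < N * F \<and> j mod F \<in> {r. r < F \<and> \<not> P u r}}" for u
  have card_C: "card (C u) = N * (F - c)" if "u \<in> {1..K}" for u
  proof -
    have "{r. r < F \<and> \<not> P u r} = {..<F} - {r\<in>{..<F}. P u r}" by auto
    moreover have "card {r\<in>{..<F}. P u r} = c" using pda_card[OF pda that] .
    ultimately have "card {r. r < F \<and> \<not> P u r} = F - c"
      by (simp add: card_Diff_subset subset_iff)
    then show ?thesis unfolding C_def by (subst card_residues_in) auto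
  qed
  have "\<exists>h. bij_betw h {..<N * (F - c)} (C u)" if "u \<in> {1..K}" for u
  proof -
    have "finite (C u)" by (simp add: C_def)
    from finite_same_card_bij[OF _ this, of "{..<N * (F - c)}"] card_C[OF that]
    show ?thesis by simp
  qed
  then obtain h where h: "\<And>u. u \<in> {1..K} \<Longrightarrow> bij_betw (h u) {..<N * (F - c)} (C u)"
    by metis
  \<comment> \<open>A cache must be a vector of length \<open>N * (F - c)\<close>, so
    \<open>h u\<close> lists the cached positions; any order will do.\<close>
  define phi :: "nat \<Rightarrow> 'a vec \<Rightarrow> 'a vec" where
    "phi u w = vec (N * (F - c)) (\<lambda>i. w $ h u i)" for u w
  \<comment> \<open>\<open>E s\<close> collects the cells carrying symbol \<open>s\<close>; their
    requested subfiles are added up to form entry \<open>s\<close> of the transmission. Files are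
    numbered from 1 and vector entries from 0, hence \<open>d u - 1\<close>.\<close>
  define E where "E s = {(u, r). u \<in> {1..K} \<and> r < F \<and> P u r \<and> e u r = s}" for s
  define enc :: "(nat \<Rightarrow> nat) \<Rightarrow> 'a vec \<Rightarrow> 'a vec" where
    "enc d w = vec S (\<lambda>s. \<Sum>(u, r)\<in>E s. w $ ((d u - 1) * F + r))" for d w
  have fin_E: "finite (E s)" for s
    by (rule finite_subset[of _ "{1..K} \<times> {..<F}"]) (auto simp: E_def)
  have cached: "w $ j = w' $ j" if u: "u \<in> {1..K}" and eq: "phi u w = phi u w'" and j: "j \<in> C u" for u w w' j
  proof -
    have "j \<in> h u ` {..<N * (F - c)}" using j by (simp add: bij_betw_imp_surj_on[OF h[OF u]])
    then obtain i where i: "i < N * (F - c)" "h u i = j" by auto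
    have "phi u w $ i = phi u w' $ i" using eq by simp
    then show ?thesis using i by (simp add: phi_def)
  qed
  \<comment> \<open>No decoder is written down. Two choices of files with equal cache and equal
    transmission are shown to agree on the requested file.\<close>
  have determined: "W (d u) = W' (d u)"
    if u: "u \<in> {1..K}" and d: "d \<in> {1..K} \<rightarrow>\<^sub>E {1..N}"
      and W: "W \<in> {1..N} \<rightarrow> carrier_vec F" and W': "W' \<in> {1..N} \<rightarrow> carrier_vec F"
      and phi: "phi u (concat_files N F W) = phi u (concat_files N F W')"
      and enc: "enc d (concat_files N F W) = enc d (concat_files N F W')"
    for u d and W W' :: "nat \<Rightarrow> 'a vec"
  proof -
    let ?w = "concat_files N F W" and ?w' = "concat_files N F W'"
    have dN: "d x \<in> {1..N}" if "x \<in> {1..K}" for x using d that by blast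
    \<comment> \<open>A row that \<open>u\<close> does not miss is cached for all files, hence also
      for the file requested by any other user \<open>x\<close>.\<close>
    have known: "?w $ ((d x - 1) * F + y) = ?w' $ ((d x - 1) * F + y)"
      if "x \<in> {1..K}" "y < F" "\<not> P u y" for x y
      using that file_position_less[OF dN that(2)] by (intro cached[OF u phi]) (auto simp: C_def)
    have "W (d u) $ r = W' (d u) $ r" if r: "r < F" for r
    proof -
      let ?t = "\<lambda>w::'a vec. \<lambda>(x, y). w $ ((d x - 1) * F + y)"
      have "?t ?w (u, r) = ?t ?w' (u, r)"
      proof (cases "P u r")
        case False
        then show ?thesis using known[OF u r] by simp
      next
        case True
        define s where "s = e u r"
        have mem: "(u, r) \<in> E s" using u r True by (simp add: E_def s_def)
        have "s < S" using pda_symbol[OF pda u _ True] r by (simp add: s_def)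
        moreover have "enc d ?w $ s = enc d ?w' $ s" using enc by simp
        ultimately have sums: "(\<Sum>x\<in>E s. ?t ?w x) = (\<Sum>x\<in>E s. ?t ?w' x)"
          by (simp add: enc_def)
        have "(\<Sum>x\<in>E s - {(u, r)}. ?t ?w x) = (\<Sum>x\<in>E s - {(u, r)}. ?t ?w' x)"
        proof (rule sum.cong[OF refl])
          fix p assume p: "p \<in> E s - {(u, r)}"
          obtain x y where xy: "p = (x, y)" by fastforce
          have x: "x \<in> {1..K}" and y: "y < F" and P: "P x y" "e u r = e x y" "(u, r) \<noteq> (x, y)"
            using p xy by (auto simp: E_def s_def)
          \<comment> \<open>The defining property of the array: no other cell with symbol
            \<open>s\<close> lies in a row missed by \<open>u\<close>. So the remaining summands
            agree, and equality of the sums leaves equality of the term at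
            \<open>(u, r)\<close>.\<close>
          have "\<not> P u y"
            using pda_unique[OF pda u _ x _ True P(1,2)] r y P(3) by auto
          then show "?t ?w p = ?t ?w' p" using known[OF x y] xy by simp
        qed
        then show ?thesis
          using sums sum.remove[OF fin_E mem, of "?t ?w"] sum.remove[OF fin_E mem, of "?t ?w'"]
          by simp
      qed
      then show ?thesis using concat_files_index[OF dN[OF u] r, where 'a = 'a] by simp
    qed
    moreover have "W (d u) \<in> carrier_vec F" "W' (d u) \<in> carrier_vec F"
      using W W' dN[OF u] by auto
    ultimately show ?thesis by (intro eq_vecI) auto
  qed
  have "\<exists>g. (\<forall>x. g x \<in> carrier_vec F) \<and> (\<forall>W\<in>{1..N} \<rightarrow> carrier_vec F.
          W (d u) = g (phi u (concat_files N F W), enc d (concat_files N F W)))"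
    if "u \<in> {1..K}" "d \<in> {1..K} \<rightarrow>\<^sub>E {1..N}" for u d
  \<comment> \<open>The zero vector is the default output; it only serves to land in
    \<open>carrier_vec F\<close>.\<close>
  proof (rule decoder_exists[where c = "0\<^sub>v F"])
    have "d u \<in> {1..N}" using that by blast
    then show "W (d u) \<in> carrier_vec F" if "W \<in> {1..N} \<rightarrow> carrier_vec F" for W :: "nat \<Rightarrow> 'a vec"
      using that by auto
  qed (use determined[OF that] in auto)
  then obtain dec :: "nat \<Rightarrow> (nat \<Rightarrow> nat) \<Rightarrow> 'a vec \<times> 'a vec \<Rightarrow> 'a vec" where dec:
    "\<And>u d. u \<in> {1..K} \<Longrightarrow> d \<in> {1..K} \<rightarrow>\<^sub>E {1..N} \<Longrightarrow> (\<forall>x. dec u d x \<in> carrier_vec F) \<and>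
       (\<forall>W\<in>{1..N} \<rightarrow> carrier_vec F.
          W (d u) = dec u d (phi u (concat_files N F W), enc d (concat_files N F W)))"
    by metis
  \<comment> \<open>Both products are natural numbers by hypothesis, so the floors lose
    nothing.\<close>
  have floors: "nat \<lfloor>M * real F\<rfloor> = N * (F - c)" "nat \<lfloor>R * real F\<rfloor> = S"
    unfolding M R(2) by (simp_all only: floor_of_nat nat_int)
  have "M * real F \<in> \<int>" unfolding M by simp
  then have "caching_scheme K M N F R phi enc dec"
    unfolding caching_scheme_def floors using sys F R(1) dec
    by (auto simp: phi_def enc_def)
  then show ?thesis unfolding admits_caching_scheme_def by blast
qed

section \<open>Renaming and copying arrays\<close>

text \<open>Users and rows are arguments of \<open>P\<close> and \<open>e\<close>, so
  \<open>f\<close> and \<open>g\<close> lead from the new array to the old one. Symbols are values,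
  so \<open>h\<close> goes the other way; it is injective on \<open>Z\<close> only, which is why
  membership of both symbols is needed.\<close>

lemma pda_reindex:
  assumes pda: "pda X Y Z P e c"
    and f: "bij_betw f X' X" and g: "bij_betw g Y' Y" and h: "bij_betw h Z Z'"
  shows "pda X' Y' Z' (\<lambda>x y. P (f x) (g y)) (\<lambda>x y. h (e (f x) (g y))) c"
proof (rule pdaI)
  have fX: "f x \<in> X" if "x \<in> X'" for x using bij_betw_apply[OF f that] .
  have gY: "g y \<in> Y" if "y \<in> Y'" for y using bij_betw_apply[OF g that] .
  have hZ: "h z \<in> Z'" if "z \<in> Z" for z using bij_betw_apply[OF h that] .
  show "finite X'" "finite Y'" "finite Z'"
    using pda_finite[OF pda] bij_betw_finite[OF f] bij_betw_finite[OF g] bij_betw_finite[OF h]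
    by simp_all
  show "card {y \<in> Y'. P (f x) (g y)} = c" if "x \<in> X'" for x
  proof -
    have "bij_betw g {y \<in> Y'. P (f x) (g y)} {y \<in> Y. P (f x) y}"
      using g by (auto simp: bij_betw_def inj_on_def)
    then show ?thesis using pda_card[OF pda fX[OF that]] by (simp add: bij_betw_same_card)
  qed
  show "h (e (f x) (g y)) \<in> Z'" if "x \<in> X'" "y \<in> Y'" "P (f x) (g y)" for x y
    using that by (intro hZ pda_symbol[OF pda] fX gY)
  show "x = x' \<and> y = y'"
    if x: "x \<in> X'" and y: "y \<in> Y'" and x': "x' \<in> X'" and y': "y' \<in> Y'"
      and P: "P (f x) (g y)" "P (f x') (g y')" "P (f x) (g y')"
      and eq: "h (e (f x) (g y)) = h (e (f x') (g y'))" for x y x' y'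
  proof -
    have "e (f x) (g y) = e (f x') (g y')"
      using bij_betw_imp_inj_on[OF h] eq
        pda_symbol[OF pda fX[OF x] gY[OF y] P(1)] pda_symbol[OF pda fX[OF x'] gY[OF y'] P(2)]
      by (rule inj_onD)
    then have "f x = f x' \<and> g y = g y'"
      using P by (intro pda_unique[OF pda] fX gY x y x' y')
    then show ?thesis
      using inj_onD[OF bij_betw_imp_inj_on[OF f] _ x x'] inj_onD[OF bij_betw_imp_inj_on[OF g] _ y y']
      by blast
  qed
qed

lemma pda_admits:
  assumes pda: "pda X Y Z P e c"
    and "caching_system (card X) M N" "0 < card Y"
    and "M * real (card Y) = real (N * (card Y - c))"
    and "0 \<le> R" "R * real (card Y) = real (card Z)"
  shows "admits_caching_scheme TYPE('a::{field,finite}) (card X) M N (card Y) R"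
proof -
  have fin: "finite X" "finite Y" "finite Z" using pda_finite[OF pda] by simp_all
  obtain f where f: "bij_betw f {1..card X} X"
    using finite_same_card_bij[of "{1..card X}" X] fin by auto
  obtain g where g: "bij_betw g {..<card Y} Y"
    using finite_same_card_bij[of "{..<card Y}" Y] fin by auto
  obtain h where h: "bij_betw h Z {..<card Z}"
    using finite_same_card_bij[of Z "{..<card Z}"] fin by auto
  show ?thesis using pda_nat_admits[OF pda_reindex[OF pda f g h]] assms by blast
qed

text \<open>Tagging symbols with the copy index keeps the copies apart, and a user misses rows of
  its own copy only, so \<open>c\<close> is unchanged. Users, rows and symbols are all multiplied by
  \<open>card I\<close>.\<close>

lemma pda_copies:
  assumes pda: "pda X Y Z P e c" and I: "finite I"
  shows "pda (I \<times> X) (I \<times> Y) (I \<times> Z) (\<lambda>(i, x) (j, y). i = j \<and> P x y) (\<lambda>(i, x) (j, y). (i, e x y)) c"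
proof (rule pdaI)
  show "finite (I \<times> X)" "finite (I \<times> Y)" "finite (I \<times> Z)"
    using pda_finite[OF pda] I by simp_all
  show "card {q \<in> I \<times> Y. (\<lambda>(i, x) (j, y). i = j \<and> P x y) p q} = c"
    if "p \<in> I \<times> X" for p
  proof -
    obtain i x where p: "p = (i, x)" by fastforce
    have "{q \<in> I \<times> Y. (\<lambda>(i, x) (j, y). i = j \<and> P x y) p q} = {i} \<times> {y \<in> Y. P x y}"
      using that p by auto
    moreover have "x \<in> X" using that p by simp
    ultimately show ?thesis using pda_card[OF pda] by (simp add: card_cartesian_product)
  qed
next
  fix p q p' q'
  assume mem: "p \<in> I \<times> X" "q \<in> I \<times> Y" "p' \<in> I \<times> X" "q' \<in> I \<times> Y"
    and P: "(\<lambda>(i, x) (j, y). i = j \<and> P x y) p q" "(\<lambda>(i, x) (j, y). i = j \<and> P x y) p' q'"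
      "(\<lambda>(i, x) (j, y). i = j \<and> P x y) p q'"
    and eq: "(\<lambda>(i, x) (j, y). (i, e x y)) p q = (\<lambda>(i, x) (j, y). (i, e x y)) p' q'"
  obtain i x j y i' x' j' y' where split: "p = (i, x)" "q = (j, y)" "p' = (i', x')" "q' = (j', y')"
    by (metis surj_pair)
  have "x = x' \<and> y = y'"
    using mem P eq unfolding split by (intro pda_unique[OF pda]) auto
  then show "p = p' \<and> q = q'" using P eq unfolding split by auto
qed (use pda_symbol[OF pda] in auto)

section \<open>Three arrays on the subsets of a finite set\<close>

definition subsets_of_size :: "'a set \<Rightarrow> nat \<Rightarrow> 'a set set" where
  "subsets_of_size S n = {A. A \<subseteq> S \<and> card A = n}"

lemma finite_subsets_of_size: "finite S \<Longrightarrow> finite (subsets_of_size S n)"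
  unfolding subsets_of_size_def by (rule finite_subset[of _ "Pow S"]) auto

lemma card_subsets_of_size: "finite S \<Longrightarrow> card (subsets_of_size S n) = card S choose n"
  unfolding subsets_of_size_def by (rule n_subsets)

text \<open>If \<open>A\<close> is disjoint from \<open>T'\<close> and contained in
  \<open>A' \<union> T'\<close>, then it lies in \<open>A'\<close>; equal sizes give
  \<open>A = A'\<close>, and removing it from the union gives \<open>T = T'\<close>.\<close>

lemma pda_disjoint_subsets:
  assumes "finite S"
  shows "pda (subsets_of_size S a) (subsets_of_size S c) (subsets_of_size S (a + c))
           (\<lambda>A T. A \<inter> T = {}) (\<union>) ((card S - a) choose c)"
proof (rule pdaI)
  have fin: "finite A" if "A \<subseteq> S" for A using assms that by (rule finite_subset[rotated])
  show "card {T \<in> subsets_of_size S c. A \<inter> T = {}} = (card S - a) choose c"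
    if "A \<in> subsets_of_size S a" for A
  proof -
    have "{T \<in> subsets_of_size S c. A \<inter> T = {}} = subsets_of_size (S - A) c"
      by (auto simp: subsets_of_size_def)
    then show ?thesis
      using assms that fin card_Diff_subset[of A S]
      by (simp add: card_subsets_of_size) (simp add: subsets_of_size_def)
  qed
  show "A \<union> T \<in> subsets_of_size S (a + c)"
    if "A \<in> subsets_of_size S a" "T \<in> subsets_of_size S c" "A \<inter> T = {}" for A T
    using that fin by (auto simp: subsets_of_size_def card_Un_disjoint)
  show "A = A' \<and> T = T'"
    if "A \<in> subsets_of_size S a" "A' \<in> subsets_of_size S a" "A \<inter> T = {}" "A' \<inter> T' = {}"
      "A \<union> T = A' \<union> T'" "A \<inter> T' = {}" for A T A' T'
  proof -
    have "A \<subseteq> A'" using that by blast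
    then have "A = A'"
      using that fin by (intro card_subset_eq) (auto simp: subsets_of_size_def)
    then show ?thesis using that by blast
  qed
qed (simp_all add: assms finite_subsets_of_size)

text \<open>\<open>A\<close> is disjoint from \<open>U - A\<close>, which equals
  \<open>U' - A'\<close>; so \<open>A \<subseteq> U'\<close> forces \<open>A \<subseteq> A'\<close>,
  and equal sizes finish.\<close>

lemma pda_supersets:
  assumes "finite S"
  shows "pda (subsets_of_size S a) (subsets_of_size S (a + c)) (subsets_of_size S c)
           (\<subseteq>) (\<lambda>A U. U - A) ((card S - a) choose c)"
proof (rule pdaI)
  have fin: "finite A" if "A \<subseteq> S" for A using assms that by (rule finite_subset[rotated])
  show diff: "U - A \<in> subsets_of_size S c"
    if "A \<in> subsets_of_size S a" "U \<in> subsets_of_size S (a + c)" "A \<subseteq> U" for A U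
    using that fin by (auto simp: subsets_of_size_def card_Diff_subset)
  show "card {U \<in> subsets_of_size S (a + c). A \<subseteq> U} = (card S - a) choose c"
    if A: "A \<in> subsets_of_size S a" for A
  proof -
    \<comment> \<open>A superset of \<open>A\<close> is determined by the \<open>c\<close> points
      added to it.\<close>
    have "bij_betw (\<lambda>U. U - A) {U \<in> subsets_of_size S (a + c). A \<subseteq> U} (subsets_of_size (S - A) c)"
    proof (rule bij_betwI[where g = "\<lambda>T. A \<union> T"])
      show "(\<lambda>U. U - A) \<in> {U \<in> subsets_of_size S (a + c). A \<subseteq> U} \<rightarrow> subsets_of_size (S - A) c"
        using diff[OF A] by (auto simp: subsets_of_size_def)
      have "card (A \<union> T) = a + c" if "T \<subseteq> S - A" "card T = c" for T
      proof -
        have "card (A \<union> T) = card A + card T"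
          using that A fin by (intro card_Un_disjoint) (auto simp: subsets_of_size_def)
        then show ?thesis using that A by (simp add: subsets_of_size_def)
      qed
      then show "(\<lambda>T. A \<union> T) \<in> subsets_of_size (S - A) c \<rightarrow> {U \<in> subsets_of_size S (a + c). A \<subseteq> U}"
        using A by (auto simp: subsets_of_size_def)
    qed (auto simp: subsets_of_size_def)
    then show ?thesis
      using assms A fin card_Diff_subset[of A S]
      by (simp add: bij_betw_same_card card_subsets_of_size) (simp add: subsets_of_size_def)
  qed
  show "A = A' \<and> U = U'"
    if "A \<in> subsets_of_size S a" "A' \<in> subsets_of_size S a" "A \<subseteq> U" "A' \<subseteq> U'"
      "U - A = U' - A'" "A \<subseteq> U'" for A U A' U'
  proof -
    have "A \<subseteq> A'" using that by blast
    then have "A = A'"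
      using that fin by (intro card_subset_eq) (auto simp: subsets_of_size_def)
    then show ?thesis using that by blast
  qed
qed (simp_all add: assms finite_subsets_of_size)

text \<open>The previous array with users and rows exchanged. The cell to exclude is now
  \<open>A' \<subseteq> U\<close>: as \<open>A'\<close> avoids \<open>U' - A'\<close>, which equals
  \<open>U - A\<close>, it would lie in \<open>A\<close>.\<close>

lemma pda_subsets:
  assumes "finite S"
  shows "pda (subsets_of_size S (a + c)) (subsets_of_size S a) (subsets_of_size S c)
           (\<lambda>U A. A \<subseteq> U) (-) ((a + c) choose a)"
proof (rule pdaI)
  have fin: "finite A" if "A \<subseteq> S" for A using assms that by (rule finite_subset[rotated])
  show "U - A \<in> subsets_of_size S c"
    if "A \<in> subsets_of_size S a" "U \<in> subsets_of_size S (a + c)" "A \<subseteq> U" for A U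
    using that fin by (auto simp: subsets_of_size_def card_Diff_subset)
  show "card {A \<in> subsets_of_size S a. A \<subseteq> U} = (a + c) choose a"
    if U: "U \<in> subsets_of_size S (a + c)" for U
  proof -
    have "{A \<in> subsets_of_size S a. A \<subseteq> U} = subsets_of_size U a"
      using U by (auto simp: subsets_of_size_def)
    then show ?thesis using U fin card_subsets_of_size[of U a] by (simp add: subsets_of_size_def)
  qed
  show "U = U' \<and> A = A'"
    if "A \<in> subsets_of_size S a" "A' \<in> subsets_of_size S a" "A \<subseteq> U" "A' \<subseteq> U'"
      "U - A = U' - A'" "A' \<subseteq> U" for A U A' U'
  proof -
    have "A' \<subseteq> A" using that by blast
    then have "A' = A"
      using that fin by (intro card_subset_eq) (auto simp: subsets_of_size_def)
    then show ?thesis using that by blast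
  qed
qed (simp_all add: assms finite_subsets_of_size)

section \<open>Counting in designs\<close>

text \<open>Double counting of incidences between a set and a multiset; induction on the multiset
  takes care of multiplicities.\<close>

lemma sum_size_filter_mset:
  assumes "finite A"
  shows "(\<Sum>T\<in>A. size {#b \<in># B. Q T b#}) = (\<Sum>b\<in>#B. card {T\<in>A. Q T b})"
proof (induction B)
  case (add b B)
  have "(\<Sum>T\<in>A. size {#b \<in># add_mset b B. Q T b#})
        = (\<Sum>T\<in>A. (if Q T b then 1 else 0) + size {#b \<in># B. Q T b#})"
    by (intro sum.cong) auto
  also have "\<dots> = card {T\<in>A. Q T b} + (\<Sum>b\<in>#B. card {T\<in>A. Q T b})"
    using assms by (simp only: sum.distrib add.IH) (simp flip: sum.inter_filter)
  finally show ?case by simp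
qed simp

lemma t_design_number_of_blocks:
  assumes "t_design V B t v k lam"
  shows "size B * (k choose t) = lam * (v choose t)"
proof -
  have V: "finite V" "card V = v"
    and B: "\<And>b. b \<in># B \<Longrightarrow> b \<subseteq> V \<and> card b = k"
    and T: "\<And>T. T \<in> subsets_of_size V t \<Longrightarrow> size {#b \<in># B. T \<subseteq> b#} = lam"
    using assms unfolding t_design_def subsets_of_size_def by auto
  have "lam * (v choose t) = (\<Sum>T\<in>subsets_of_size V t. size {#b \<in># B. T \<subseteq> b#})"
    using T V by (simp add: card_subsets_of_size)
  also have "\<dots> = (\<Sum>b\<in>#B. card {T \<in> subsets_of_size V t. T \<subseteq> b})"
    using V by (intro sum_size_filter_mset finite_subsets_of_size)
  also have "\<dots> = (\<Sum>b\<in>#B. k choose t)"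
  proof (intro arg_cong[where f = sum_mset] image_mset_cong)
    fix b assume b: "b \<in># B"
    have "{T \<in> subsets_of_size V t. T \<subseteq> b} = subsets_of_size b t"
      using B[OF b] by (auto simp: subsets_of_size_def)
    then show "card {T \<in> subsets_of_size V t. T \<subseteq> b} = k choose t"
      using B[OF b] V finite_subset by (metis card_subsets_of_size)
  qed
  finally show ?thesis by simp
qed

text \<open>Identifies the fractions in the parameters as the number of pairs of a block and an
  \<open>s\<close>-subset of it. Only the case \<open>s = t\<close> is counted directly; the rest is
  \<open>choose_mult\<close>, applied once to the points of the design and once to those of a
  block.\<close>

lemma t_design_flags:
  assumes design: "t_design V B t v k lam" and s: "s \<le> t"
  shows "real (lam * (v choose s) * ((v - s) choose (t - s))) / real ((k - s) choose (t - s))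
         = real (size B * (k choose s))"
proof -
  have tk: "t \<le> k" "t \<le> v" using design by (auto simp: t_design_def)
  have "lam * (v choose s) * ((v - s) choose (t - s)) = lam * (v choose t) * (t choose s)"
    using choose_mult[OF s tk(2)] by (simp add: mult.assoc)
  also have "\<dots> = size B * ((k choose t) * (t choose s))"
    using t_design_number_of_blocks[OF design] by (simp add: mult.assoc)
  also have "\<dots> = size B * (k choose s) * ((k - s) choose (t - s))"
    using choose_mult[OF s tk(1)] by (simp add: mult.assoc)
  finally have "real (lam * (v choose s) * ((v - s) choose (t - s)))
                = real (size B * (k choose s)) * real ((k - s) choose (t - s))"
    by (simp only: of_nat_mult)
  moreover have "0 < (k - s) choose (t - s)" using tk s by simp
  ultimately show ?thesis by simp
qed

lemma t_design_size_pos: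
  assumes "t_design V B t v k lam"
  shows "0 < size B"
proof -
  have "0 < lam * (v choose t)" using assms by (auto simp: t_design_def)
  then show ?thesis by (intro gr0I) (simp flip: t_design_number_of_blocks[OF assms])
qed

section \<open>Schemes from designs\<close>

text \<open>Treats the three parameter sets at once: \<open>x\<close>, \<open>y\<close> and
  \<open>z\<close> are the subset sizes for users, rows and symbols. The design enters through its
  number of blocks alone, one copy of the array per block, and this number cancels in the
  rate.\<close>

lemma t_design_admits:
  assumes design: "t_design V B t v k lam" and xy: "x \<le> t" "y \<le> t"
    and pda: "pda (subsets_of_size {..<k} x) (subsets_of_size {..<k} y) (subsets_of_size {..<k} z) P e c"
    and sys: "caching_system K M N"
    and K: "real K = real (lam * (v choose x) * ((v - x) choose (t - x))) / real ((k - x) choose (t - x))"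
    and M: "M / real N = 1 - real (c * ((k - y) choose (t - y))) / real (lam * (v choose y) * ((v - y) choose (t - y)))"
  shows "\<exists>F. real F = real (lam * (v choose y) * ((v - y) choose (t - y))) / real ((k - y) choose (t - y)) \<and>
             admits_caching_scheme TYPE('a::{field,finite}) K M N F (real (k choose z) / real (k choose y))"
proof -
  have tk: "t \<le> k" using design by (auto simp: t_design_def)
  define F where "F = size B * (k choose y)"
  have F: "real F = real (lam * (v choose y) * ((v - y) choose (t - y))) / real ((k - y) choose (t - y))"
    using t_design_flags[OF design xy(2)] by (simp add: F_def)
  have ky: "0 < k choose y" using xy tk by simp
  have Fpos: "0 < F" using t_design_size_pos[OF design] ky by (simp add: F_def)
  define cp where "cp n = {..<size B} \<times> subsets_of_size {..<k} n" for n
  have card_cp: "card (cp n) = size B * (k choose n)" for n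
    by (simp add: cp_def card_cartesian_product card_subsets_of_size)
  note copies = pda_copies[OF pda finite_lessThan[of "size B"], folded cp_def]
  have "real K = real (card (cp x))" using K t_design_flags[OF design xy(1)] card_cp by simp
  then have Kx: "K = card (cp x)" by simp
  have Fy: "F = card (cp y)" by (simp add: F_def card_cp)
  have N: "0 < N" and K0: "0 < K" using sys by (auto simp: caching_system_def)
  \<comment> \<open>Makes the natural subtraction \<open>F - c\<close> a true difference. Any user
    shows it, and one exists because \<open>K\<close> is positive.\<close>
  have "c \<le> F"
  proof -
    have "cp x \<noteq> {}" using Kx K0 by auto
    then obtain q where "q \<in> cp x" by blast
    then have "card {r \<in> cp y. (\<lambda>(i, x) (j, y). i = j \<and> P x y) q r} = c"
      using pda_card[OF copies] by blast
    moreover have "card {r \<in> cp y. (\<lambda>(i, x) (j, y). i = j \<and> P x y) q r} \<le> card (cp y)"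
      using pda_finite[OF copies] by (intro card_mono) auto
    ultimately show ?thesis using Fy by simp
  qed
  have "real (c * ((k - y) choose (t - y))) / real (lam * (v choose y) * ((v - y) choose (t - y)))
        = real c / real F"
    unfolding F by simp
  then have "M / real N = 1 - real c / real F" using M by simp
  then have "M * real F = real N * (real F - real c)"
    using N Fpos by (simp add: field_simps)
  then have "M * real F = real (N * (F - c))" using \<open>c \<le> F\<close> by (simp add: of_nat_diff)
  moreover have "real (k choose z) / real (k choose y) * real F = real (card (cp z))"
    using ky by (simp add: F_def card_cp)
  ultimately have "admits_caching_scheme TYPE('a) K M N F (real (k choose z) / real (k choose y))"
    using pda_admits[OF copies, of M N "real (k choose z) / real (k choose y)"] sys Fpos
    unfolding Kx Fy by simp
  then show ?thesis using F by blast
qed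

theorem theorem7:
  fixes V :: "'p set" and B :: "'p set multiset"
    and t v k lam t0 t1 t2 :: nat
  assumes design: "t_design V B t v k lam" and lam: "1 \<le> lam"
    and pos: "0 < t0" "0 < t1" "0 < t2"
    and t0_eq: "t0 = t1 + t2" and t0_le: "t0 \<le> t"
  shows "(\<forall>K M N.
            caching_system K M N \<and>
            real K = real (lam * (v choose t1) * ((v - t1) choose (t - t1))) / real ((k - t1) choose (t - t1)) \<and>
            M / real N = 1 - real (((k - t1) choose t2) * ((k - t2) choose (t - t2))) / real (lam * (v choose t2) * ((v - t2) choose (t - t2)))
            \<longrightarrow> (\<exists>F. real F = real (lam * (v choose t2) * ((v - t2) choose (t - t2))) / real ((k - t2) choose (t - t2)) \<and>
                     admits_caching_scheme TYPE('a::{field,finite}) K M N F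
                       (real (k choose t0) / real (k choose t2)))) \<and>
         (\<forall>K M N.
            caching_system K M N \<and>
            real K = real (lam * (v choose t1) * ((v - t1) choose (t - t1))) / real ((k - t1) choose (t - t1)) \<and>
            M / real N = 1 - real (((k - t1) choose t2) * ((k - t0) choose (t - t0))) / real (lam * (v choose t0) * ((v - t0) choose (t - t0)))
            \<longrightarrow> (\<exists>F. real F = real (lam * (v choose t0) * ((v - t0) choose (t - t0))) / real ((k - t0) choose (t - t0)) \<and>
                     admits_caching_scheme TYPE('a::{field,finite}) K M N F
                       (real (k choose t2) / real (k choose t0)))) \<and>
         (\<forall>K M N.
            caching_system K M N \<and>
            real K = real (lam * (v choose t0) * ((v - t0) choose (t - t0))) / real ((k - t0) choose (t - t0)) \<and>
            M / real N = 1 - real ((t0 choose t1) * ((k - t1) choose (t - t1))) / real (lam * (v choose t1) * ((v - t1) choose (t - t1)))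
            \<longrightarrow> (\<exists>F. real F = real (lam * (v choose t1) * ((v - t1) choose (t - t1))) / real ((k - t1) choose (t - t1)) \<and>
                     admits_caching_scheme TYPE('a::{field,finite}) K M N F
                       (real (k choose t2) / real (k choose t1))))"
proof -
  have le: "t1 \<le> t" "t2 \<le> t" using t0_eq t0_le by auto
  \<comment> \<open>With \<open>a = t1\<close> and \<open>c = t2\<close> the size
    \<open>a + c\<close> folds to \<open>t0\<close>, so the three arrays have sizes of users, rows,
    symbols \<open>(t1, t2, t0)\<close>, \<open>(t1, t0, t2)\<close> and
    \<open>(t0, t1, t2)\<close>.\<close>
  note disjoint = pda_disjoint_subsets[OF finite_lessThan[of k], of t1 t2, folded t0_eq, unfolded card_lessThan]
  note supersets = pda_supersets[OF finite_lessThan[of k], of t1 t2, folded t0_eq, unfolded card_lessThan]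
  note subsets = pda_subsets[OF finite_lessThan[of k], of t1 t2, folded t0_eq, unfolded card_lessThan]
  note cases = t_design_admits[OF design le(1,2) disjoint] t_design_admits[OF design le(1) t0_le supersets]
    t_design_admits[OF design t0_le le(1) subsets]
  show ?thesis
    by (intro conjI allI impI; elim conjE) (rule cases(1) cases(2) cases(3); assumption)+
qed

end
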